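(* Let $\mathcal{G}_0=\langle\mathcal{V},\mathcal{E}\rangle$ be a finite directed graph whose nodes have profiles over a schema of categorical attributes $\mathcal{A}=\{A_1,\ldots,A_m\}$, and let $\xi$ be a positive integer (radius). Then the Hamming-based diversity function $div:2^{\mathcal{V}}\to\mathbb{R}$, $$div(S)=\Bigl|\bigcup_{v\in S}\mathcal{B}^{\xi}_v\Bigr|,$$ where $\mathcal{B}^{\xi}_v$ is the Hamming ball of $v$ with radius $\xi$, is (nondecreasing) monotone and submodular.
   Context: Each attribute $A$ has a domain $dom_A$ of admissible values; each node $v\in\mathcal{V}$ has a profile giving, for each attribute $A$, either a value $val_A(v)\in dom_A$ or a missing value. The Hamming distance between nodes $u,v$ is $dist^H(u,v)=\sum_{j=1}^m\mathbf{1}[val_{A_j}(u)\ne val_{A_j}(v)]$, where $\mathbf{1}[\cdot]$ is the indicator function, and the $j$-th indicator is taken equal to $1$ if $u$ or $v$ has a missing value for $A_j$. The influence range $\mathrm{IR}(v)\subseteq\mathcal{V}$ is the set of nodes $u$ for which there exists a path connecting $v$ to $u$. The Hamming ball of $v$ is $\mathcal{B}_v^{\xi}=\{u\mid u\in\mathrm{IR}(v)\wedge dist^H(u,v)\le\xi\}$. A set function $F:2^{\mathcal{V}}\to\mathbb{R}$ is monotone if $F(S)\le F(T)$ whenever $S\subseteq T\subseteq\mathcal{V}$, and submodular if $F(S\cup\{v\})-F(S)\ge F(T\cup\{v\})-F(T)$ whenever $S\subseteq T\subseteq\mathcal{V}$ and $v\in\mathcal{V}\setminus T$. *)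

theory Defs
  imports Complex_Main "Graph_Theory.Pair_Digraph" "Graph_Theory.Arc_Walk"
begin

text \<open>
  The profile of a node \<open>v\<close> is given by \<open>val A v :: 'c option\<close>, where \<open>None\<close> encodes a missing
  value. A missing value on either side counts as a mismatch, so the distance of a node to itself
  need not be 0 and plain inequality of the two options would not do.
\<close>

definition hamming_dist :: "'a set \<Rightarrow> ('a \<Rightarrow> 'v \<Rightarrow> 'c option) \<Rightarrow> 'v \<Rightarrow> 'v \<Rightarrow> nat" where
  "hamming_dist Att val u v =
    (\<Sum>A\<in>Att. of_bool (val A u = None \<or> val A v = None \<or> val A u \<noteq> val A v))"

text \<open>
  \<open>apath\<close> is the library's notion of a directed path without repeated nodes. It includes the path
  of length 0, so every node lies in its own influence range.
\<close>

definition influence_range :: "'v pair_pre_digraph \<Rightarrow> 'v \<Rightarrow> 'v set" where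
  "influence_range G v = {u. \<exists>p. pre_digraph.apath (with_proj G) v p u}"

definition hamming_ball ::
  "'v pair_pre_digraph \<Rightarrow> 'a set \<Rightarrow> ('a \<Rightarrow> 'v \<Rightarrow> 'c option) \<Rightarrow> nat \<Rightarrow> 'v \<Rightarrow> 'v set" where
  "hamming_ball G Att val \<xi> v =
    {u. u \<in> influence_range G v \<and> hamming_dist Att val u v \<le> \<xi>}"

definition hamming_diversity ::
  "'v pair_pre_digraph \<Rightarrow> 'a set \<Rightarrow> ('a \<Rightarrow> 'v \<Rightarrow> 'c option) \<Rightarrow> nat \<Rightarrow> 'v set \<Rightarrow> real" where
  "hamming_diversity G Att val \<xi> S = real (card (\<Union>v\<in>S. hamming_ball G Att val \<xi> v))"

definition submodular_on :: "'v set \<Rightarrow> ('v set \<Rightarrow> real) \<Rightarrow> bool" where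
  "submodular_on V F \<longleftrightarrow>
    (\<forall>S T v. S \<subseteq> T \<longrightarrow> T \<subseteq> V \<longrightarrow> v \<in> V - T \<longrightarrow>
      F (S \<union> {v}) - F S \<ge> F (T \<union> {v}) - F T)"

end

theory Submission
  imports Defs
begin

text \<open>
  The marginal gain of adding \<open>v\<close> to \<open>S\<close> in a coverage function is the number of elements of
  \<open>B v\<close> not yet covered by \<open>S\<close>, which can only shrink as \<open>S\<close> grows. Hamming balls are finite
  because every path stays inside the finite graph.
\<close>

text \<open>Finiteness is essential here because \<open>card\<close> of an infinite set is 0: an
  infinite union over the larger set would count as less than a finite one over the smaller.\<close>

lemma mono_on_coverage:
  assumes "finite (\<Union>v\<in>V. B v)"
  shows "mono_on (Pow V) (\<lambda>S. real (card (\<Union>v\<in>S. B v)))"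
proof (rule mono_onI)
  fix S T assume "T \<in> Pow V" "S \<subseteq> T"
  then have "finite (\<Union>v\<in>T. B v)"
    using UN_mono[of T V B B] assms by (auto intro: finite_subset)
  then show "real (card (\<Union>v\<in>S. B v)) \<le> real (card (\<Union>v\<in>T. B v))"
    using \<open>S \<subseteq> T\<close> by (simp add: card_mono UN_mono)
qed

lemma submodular_on_coverage:
  assumes fin: "finite (\<Union>v\<in>V. B v)"
  shows "submodular_on V (\<lambda>S. real (card (\<Union>v\<in>S. B v)))"
  unfolding submodular_on_def
proof (intro allI impI)
  fix S T v
  assume ST: "S \<subseteq> T" "T \<subseteq> V" and v: "v \<in> V - T"
  have finB: "finite (B v)"
    using UN_upper[of v V B] v fin by (auto intro: finite_subset)
  \<comment> \<open>Stated for arbitrary \<open>U\<close> inside \<open>V\<close>, so that one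
    identity gives the marginal gain at both \<open>S\<close> and \<open>T\<close>. Subtraction
    takes place in the reals, free of truncation.\<close>
  have gain: "real (card (\<Union>w\<in>U \<union> {v}. B w)) - real (card (\<Union>w\<in>U. B w))
      = real (card (B v - (\<Union>w\<in>U. B w)))" if "U \<subseteq> V" for U
  proof -
    have "finite (\<Union>w\<in>U. B w)"
      using UN_mono[OF that order_refl] fin by (rule finite_subset)
    then have "card ((\<Union>w\<in>U. B w) \<union> (B v - (\<Union>w\<in>U. B w)))
        = card (\<Union>w\<in>U. B w) + card (B v - (\<Union>w\<in>U. B w))"
      using finB by (intro card_Un_disjoint) auto
    \<comment> \<open>Splitting off only the uncovered part of \<open>B v\<close> makes the union
      disjoint, so cardinalities add.\<close>
    moreover have "(\<Union>w\<in>U \<union> {v}. B w) = (\<Union>w\<in>U. B w) \<union> (B v - (\<Union>w\<in>U. B w))"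
      by auto
    ultimately show ?thesis
      by simp
  qed
  have "card (B v - (\<Union>w\<in>T. B w)) \<le> card (B v - (\<Union>w\<in>S. B w))"
    using finB ST(1) by (intro card_mono) auto
  then show "real (card (\<Union>w\<in>T \<union> {v}. B w)) - real (card (\<Union>w\<in>T. B w))
      \<le> real (card (\<Union>w\<in>S \<union> {v}. B w)) - real (card (\<Union>w\<in>S. B w))"
    using ST by (simp only: gain subset_trans[OF ST] of_nat_le_iff)
qed

text \<open>A walk starts at a vertex by definition, and well-formedness keeps the endpoints of its
  arcs in the graph. For \<open>v\<close> outside \<open>pverts G\<close> the ball is thus
  empty.\<close>

lemma hamming_ball_subset_pverts:
  assumes "pair_wf_digraph G"
  shows "hamming_ball G Att val \<xi> v \<subseteq> pverts G"
proof -
  interpret pair_wf_digraph G by fact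
  show ?thesis
    by (auto simp: hamming_ball_def influence_range_def apath_def dest: awalk_last_in_verts)
qed

theorem proposition3:
  fixes G :: "'v pair_pre_digraph"
    and Att :: "'a set"
    and dom_of :: "'a \<Rightarrow> 'c set"
    and val :: "'a \<Rightarrow> 'v \<Rightarrow> 'c option"
    and \<xi> :: nat
  assumes "pair_fin_digraph G"
    and "finite Att"
    and "\<And>A v x. A \<in> Att \<Longrightarrow> v \<in> pverts G \<Longrightarrow> val A v = Some x \<Longrightarrow> x \<in> dom_of A"
    and "\<xi> > 0"
  shows "mono_on (Pow (pverts G)) (hamming_diversity G Att val \<xi>) \<and>
    submodular_on (pverts G) (hamming_diversity G Att val \<xi>)"
proof -
  interpret pair_fin_digraph G by fact
  have "(\<Union>v\<in>pverts G. hamming_ball G Att val \<xi> v) \<subseteq> pverts G"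
    using hamming_ball_subset_pverts[OF pair_wf_digraph_axioms] by blast
  then have fin: "finite (\<Union>v\<in>pverts G. hamming_ball G Att val \<xi> v)"
    using pair_finite_verts by (rule finite_subset)
  \<comment> \<open>An equation between functions lets the coverage lemmas apply with
    \<open>B\<close> taken to be \<open>hamming_ball G Att val \<xi>\<close>.\<close>
  have "hamming_diversity G Att val \<xi>
      = (\<lambda>S. real (card (\<Union>v\<in>S. hamming_ball G Att val \<xi> v)))"
    by (simp add: hamming_diversity_def fun_eq_iff)
  then show ?thesis
    using mono_on_coverage[OF fin] submodular_on_coverage[OF fin] by simp
qed

end
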